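(* For real $\beta,\phi,t$ put $$m=\tfrac t2,\quad n=1\qquad\text{if }\beta^2=1,$$ $$m=\frac{\sinh\frac{t\sqrt{1-\beta^2}}{2}}{\sqrt{1-\beta^2}},\quad n=\cosh\frac{t\sqrt{1-\beta^2}}{2}\qquad\text{if }\beta^2<1,$$ $$m=\frac{\sin\frac{t\sqrt{\beta^2-1}}{2}}{\sqrt{\beta^2-1}},\quad n=\cos\frac{t\sqrt{\beta^2-1}}{2}\qquad\text{if }\beta^2>1.$$ Then the geodesic $\gamma(t)=\gamma(\beta,\phi;t)$ of the left-invariant sub-Riemannian metric $\delta$ on $SL(2)$ is equal to $$\begin{pmatrix} n\cos\frac{\beta t}{2}+m\left(\cos\left(\frac{\beta t}{2}+\phi\right)+\beta\sin\frac{\beta t}{2}\right) & n\sin\frac{\beta t}{2}+m\left(\sin\left(\frac{\beta t}{2}+\phi\right)-\beta\cos\frac{\beta t}{2}\right)\\ -n\sin\frac{\beta t}{2}+m\left(\sin\left(\frac{\beta t}{2}+\phi\right)+\beta\cos\frac{\beta t}{2}\right) & n\cos\frac{\beta t}{2}+m\left(-\cos\left(\frac{\beta t}{2}+\phi\right)+\beta\sin\frac{\beta t}{2}\right)\end{pmatrix}.$$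
   Context: Let $e_{ij}$ be the $2\times2$ matrix units, $p_1=\frac12(e_{11}-e_{22})$, $p_2=\frac12(e_{12}+e_{21})$, $k=\frac12(e_{21}-e_{12})$, a basis of $\mathfrak{sl}(2)$ (real traceless $2\times 2$ matrices). $\delta$ is the left-invariant sub-Riemannian metric on $SL(2)$ (real $2\times 2$ matrices with determinant 1, unit $e$) defined by the left-invariant distribution $D$ with $D(e)=\operatorname{Lin}(p_1,p_2)$ and the scalar product on $D(e)$ with orthonormal basis $p_1,p_2$. Its geodesics parametrized by arclength and starting at $e$ are $$\gamma(\beta,\phi;t)=\exp\bigl(t(\cos\phi\, p_1+\sin\phi\, p_2+\beta k)\bigr)\exp(-t\beta k),\quad t\in\mathbb{R},\ \beta,\phi\in\mathbb{R}.$$ *)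

theory Defs
  imports "HOL-Analysis.Analysis"
begin

text \<open>
  On \<^typ>\<open>real^'n^'n\<close> the library's \<open>*\<close> and \<open>^\<close> are entrywise, and there is no Banach algebra
  instance for \<^const>\<open>matrix_matrix_mult\<close> from which \<^const>\<open>exp\<close> could be taken. The matrix
  exponential is therefore defined by its power series.
\<close>

primrec matrix_power :: "real^'n^'n \<Rightarrow> nat \<Rightarrow> real^'n^'n" where
  "matrix_power A 0 = mat 1"
| "matrix_power A (Suc k) = A ** matrix_power A k"

definition matrix_exp :: "real^'n^'n \<Rightarrow> real^'n^'n" where
  "matrix_exp A = (\<Sum>k. (1 / fact k) *\<^sub>R matrix_power A k)"

lemma onorm_matrix_power_le:
  "onorm ((*v) (matrix_power A k)) \<le> onorm ((*v) A) ^ k"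
proof (induction k)
  case 0
  have "(*v) (mat 1 :: real^'n^'n) = (\<lambda>x. x)" by auto
  then show ?case by (simp add: onorm_id_le)
next
  case (Suc k)
  have "(*v) (matrix_power A (Suc k)) = (*v) A \<circ> (*v) (matrix_power A k)"
    by (auto simp: matrix_vector_mul_assoc)
  then have "onorm ((*v) (matrix_power A (Suc k)))
      \<le> onorm ((*v) A) * onorm ((*v) (matrix_power A k))"
    using onorm_compose matrix_vector_mul_bounded_linear by metis
  also have "\<dots> \<le> onorm ((*v) A) * onorm ((*v) A) ^ k"
    by (intro mult_left_mono Suc onorm_pos_le matrix_vector_mul_bounded_linear)
  finally show ?case by simp
qed

lemma summable_matrix_exp:
  fixes A :: "real^'n^'n"
  shows "summable (\<lambda>k. (1 / fact k) *\<^sub>R matrix_power A k)"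
proof (rule summable_comparison_test')
  define K where "K = onorm ((*v) A)"
  define c where "c = real CARD('n) * real CARD('n)"
  show "summable (\<lambda>k. c * (inverse (fact k) * K ^ k))"
    by (intro summable_mult summable_exp)
  fix k :: nat
  have entry: "\<bar>matrix_power A k $ i $ j\<bar> \<le> K ^ k" for i j
    using matrix_component_le_onorm[of "matrix_power A k" i j] onorm_matrix_power_le[of A k]
    by (simp add: K_def)
  have row: "norm (matrix_power A k $ i) \<le> real CARD('n) * K ^ k" for i
    using norm_le_l1_cart[of "matrix_power A k $ i"]
      sum_bounded_above[of UNIV "\<lambda>j. \<bar>matrix_power A k $ i $ j\<bar>" "K ^ k"] entry
    by fastforce
  have "norm (matrix_power A k) \<le> (\<Sum>i\<in>UNIV. norm (matrix_power A k $ i))"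
    unfolding norm_vec_def by (rule L2_set_le_sum) simp
  also have "\<dots> \<le> c * K ^ k"
    using sum_bounded_above[of UNIV "\<lambda>i. norm (matrix_power A k $ i)" "real CARD('n) * K ^ k"] row
    by (simp add: c_def mult.assoc)
  finally show "norm ((1 / fact k) *\<^sub>R matrix_power A k) \<le> c * (inverse (fact k) * K ^ k)"
    by (simp add: divide_simps)
qed

definition matrix_unit :: "'n \<Rightarrow> 'n \<Rightarrow> real^'n^'n" where
  "matrix_unit i j = (\<chi> r c. if r = i \<and> c = j then 1 else 0)"

definition p1 :: "real^2^2" where
  "p1 = (1/2) *\<^sub>R (matrix_unit 1 1 - matrix_unit 2 2)"

definition p2 :: "real^2^2" where
  "p2 = (1/2) *\<^sub>R (matrix_unit 1 2 + matrix_unit 2 1)"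

definition k_gen :: "real^2^2" where
  "k_gen = (1/2) *\<^sub>R (matrix_unit 2 1 - matrix_unit 1 2)"

text \<open>
  The arclength-parametrized geodesics, issuing from the identity, of the left-invariant
  sub-Riemannian metric on \<open>SL(2)\<close> for which \<^const>\<open>p1\<close>, \<^const>\<open>p2\<close> form an orthonormal basis of
  the distribution at the identity.
\<close>

definition geodesic :: "real \<Rightarrow> real \<Rightarrow> real \<Rightarrow> real^2^2" where
  "geodesic \<beta> \<phi> t =
     matrix_exp (t *\<^sub>R (cos \<phi> *\<^sub>R p1 + sin \<phi> *\<^sub>R p2 + \<beta> *\<^sub>R k_gen))
     ** matrix_exp (- (t *\<^sub>R (\<beta> *\<^sub>R k_gen)))"

end

theory Submission
  imports Defs
begin

text \<open>
  A traceless \<open>2 \<times> 2\<close> matrix squares to a scalar matrix, by Cayley and Hamilton. Hence the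
  exponential series of \<open>r B\<close>, for \<open>B\<close> traceless, splits into an even part that is a multiple of
  the identity and an odd part that is a multiple of \<open>B\<close>. If \<open>B ** B = \<delta> I\<close>, the two scalar series
  are those of \<open>cosh (r \<omega>)\<close> and \<open>sinh (r \<omega>) / \<omega>\<close> for \<open>\<delta> = \<omega>\<^sup>2 > 0\<close>, those of \<open>cos (r \<omega>)\<close> and
  \<open>sin (r \<omega>) / \<omega>\<close> for \<open>\<delta> = - \<omega>\<^sup>2 < 0\<close>, and reduce to \<open>1\<close> and \<open>r\<close> for \<open>\<delta> = 0\<close>.

  Both factors of a geodesic have this form. In the first one \<open>r = t / 2\<close> and
  \<open>B = 2 (cos \<phi> p\<^sub>1 + sin \<phi> p\<^sub>2 + \<beta> k)\<close>, for which \<open>\<delta> = 1 - \<beta>\<^sup>2\<close>; this gives the three cases and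
  \<open>exp (r B) = n I + m B\<close>. In the second one \<open>B = - 2 k\<close>, for which \<open>\<delta> = - 1\<close>, and the exponential
  is the rotation by the angle \<open>- \<beta> t / 2\<close>. The entries of the product are brought to the stated form
  by the addition formulas for \<open>cos (\<beta> t / 2 + \<phi>)\<close> and \<open>sin (\<beta> t / 2 + \<phi>)\<close>.
\<close>

lemma matrix_power_scaled_square_root_of_scalar:
  fixes B :: "real^'n^'n"
  assumes "B ** B = \<delta> *\<^sub>R mat 1"
  shows "matrix_power (r *\<^sub>R B) k =
    (if even k then (r ^ k * \<delta> ^ (k div 2)) *\<^sub>R mat 1 else (r ^ k * \<delta> ^ ((k - 1) div 2)) *\<^sub>R B)"
proof (induction k)
  case 0
  then show ?case by simp
next
  case (Suc k)
  show ?case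
  proof (cases "even k")
    case True
    then show ?thesis
      using Suc by (simp add: matrix_scalar_ac flip: scalar_matrix_assoc)
  next
    case False
    then obtain l where "k = 2 * l + 1" by (elim oddE)
    then show ?thesis
      using Suc assms by (simp add: matrix_scalar_ac algebra_simps flip: scalar_matrix_assoc)
  qed
qed

text \<open>
  The two scalar series run over all \<open>k\<close>, with zeros at the terms of the wrong parity, because this
  is the shape of the series of \<^const>\<open>sin\<close>, \<^const>\<open>cos\<close>, \<^const>\<open>sinh\<close> and \<^const>\<open>cosh\<close>. The
  scalar \<open>r\<close> is kept apart from \<open>B\<close> so that \<open>S\<close> becomes a quotient with denominator \<open>\<omega>\<close>, not
  \<open>r \<omega>\<close>; then \<open>r = 0\<close> is not exceptional.
\<close>

lemma matrix_exp_scaled_square_root_of_scalar: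
  fixes B :: "real^'n^'n"
  assumes B: "B ** B = \<delta> *\<^sub>R mat 1"
    and C: "(\<lambda>k. if even k then r ^ k * \<delta> ^ (k div 2) / fact k else 0) sums C"
    and S: "(\<lambda>k. if even k then 0 else r ^ k * \<delta> ^ ((k - 1) div 2) / fact k) sums S"
  shows "matrix_exp (r *\<^sub>R B) = C *\<^sub>R mat 1 + S *\<^sub>R B"
proof -
  have "(\<lambda>k. (if even k then r ^ k * \<delta> ^ (k div 2) / fact k else 0) *\<^sub>R (mat 1 :: real^'n^'n)
           + (if even k then 0 else r ^ k * \<delta> ^ ((k - 1) div 2) / fact k) *\<^sub>R B)
        sums (C *\<^sub>R mat 1 + S *\<^sub>R B)"
    by (intro sums_add sums_scaleR_left C S)
  also have "(\<lambda>k. (if even k then r ^ k * \<delta> ^ (k div 2) / fact k else 0) *\<^sub>R (mat 1 :: real^'n^'n)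
           + (if even k then 0 else r ^ k * \<delta> ^ ((k - 1) div 2) / fact k) *\<^sub>R B)
      = (\<lambda>k. (1 / fact k) *\<^sub>R matrix_power (r *\<^sub>R B) k)"
    by (auto simp: matrix_power_scaled_square_root_of_scalar[OF B])
  finally show ?thesis
    by (simp add: matrix_exp_def sums_iff)
qed

lemma matrix_exp_parabolic:
  fixes B :: "real^'n^'n"
  assumes B: "B ** B = 0"
  shows "matrix_exp (r *\<^sub>R B) = mat 1 + r *\<^sub>R B"
proof -
  have "(\<lambda>k. if even k then r ^ k * 0 ^ (k div 2) / fact k else 0) = (\<lambda>k. if k = 0 then 1 else 0)"
    by (auto simp: fun_eq_iff elim!: evenE)
  then have C: "(\<lambda>k. if even k then r ^ k * 0 ^ (k div 2) / fact k else 0) sums 1"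
    using sums_single[of 0 "\<lambda>_. 1 :: real"] by simp
  have "(\<lambda>k. if even k then 0 else r ^ k * 0 ^ ((k - 1) div 2) / fact k)
      = (\<lambda>k. if k = 1 then r else 0)"
    by (auto simp: fun_eq_iff elim!: oddE)
  then have S: "(\<lambda>k. if even k then 0 else r ^ k * 0 ^ ((k - 1) div 2) / fact k) sums r"
    using sums_single[of 1 "\<lambda>_. r"] by simp
  show ?thesis
    using matrix_exp_scaled_square_root_of_scalar[OF _ C S, of B] B by simp
qed

lemma matrix_exp_hyperbolic:
  fixes B :: "real^'n^'n"
  assumes B: "B ** B = \<omega>\<^sup>2 *\<^sub>R mat 1" and "\<omega> \<noteq> 0"
  shows "matrix_exp (r *\<^sub>R B) = cosh (r * \<omega>) *\<^sub>R mat 1 + (sinh (r * \<omega>) / \<omega>) *\<^sub>R B"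
proof (rule matrix_exp_scaled_square_root_of_scalar[OF B])
  have "(\<lambda>k. if even k then r ^ k * (\<omega>\<^sup>2) ^ (k div 2) / fact k else 0)
      = (\<lambda>k. if even k then (r * \<omega>) ^ k /\<^sub>R fact k else 0)"
    by (auto simp: fun_eq_iff power_mult_distrib field_simps simp flip: power_mult)
  then show "(\<lambda>k. if even k then r ^ k * (\<omega>\<^sup>2) ^ (k div 2) / fact k else 0) sums cosh (r * \<omega>)"
    using cosh_converges[of "r * \<omega>"] by simp
  have "(\<lambda>k. if even k then 0 else r ^ k * (\<omega>\<^sup>2) ^ ((k - 1) div 2) / fact k)
      = (\<lambda>k. (if even k then 0 else (r * \<omega>) ^ k /\<^sub>R fact k) / \<omega>)"
    using \<open>\<omega> \<noteq> 0\<close>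
    by (auto simp: fun_eq_iff power_mult_distrib field_simps simp flip: power_mult elim!: oddE)
  then show "(\<lambda>k. if even k then 0 else r ^ k * (\<omega>\<^sup>2) ^ ((k - 1) div 2) / fact k)
      sums (sinh (r * \<omega>) / \<omega>)"
    using sums_divide[OF sinh_converges[of "r * \<omega>"], of \<omega>] by simp
qed

lemma matrix_exp_elliptic:
  fixes B :: "real^'n^'n"
  assumes B: "B ** B = (- \<omega>\<^sup>2) *\<^sub>R mat 1" and "\<omega> \<noteq> 0"
  shows "matrix_exp (r *\<^sub>R B) = cos (r * \<omega>) *\<^sub>R mat 1 + (sin (r * \<omega>) / \<omega>) *\<^sub>R B"
proof (rule matrix_exp_scaled_square_root_of_scalar[OF B])
  have neg: "(- \<omega>\<^sup>2) ^ j = (- 1) ^ j * \<omega> ^ (2 * j)" for j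
    by (metis mult_minus1 power_mult power_mult_distrib)
  have "(\<lambda>k. if even k then r ^ k * (- \<omega>\<^sup>2) ^ (k div 2) / fact k else 0)
      = (\<lambda>k. cos_coeff k *\<^sub>R (r * \<omega>) ^ k)"
    by (auto simp: fun_eq_iff neg cos_coeff_def power_mult_distrib)
  then show "(\<lambda>k. if even k then r ^ k * (- \<omega>\<^sup>2) ^ (k div 2) / fact k else 0) sums cos (r * \<omega>)"
    using cos_converges[of "r * \<omega>"] by simp
  have "(\<lambda>k. if even k then 0 else r ^ k * (- \<omega>\<^sup>2) ^ ((k - 1) div 2) / fact k)
      = (\<lambda>k. (sin_coeff k *\<^sub>R (r * \<omega>) ^ k) / \<omega>)"
    using \<open>\<omega> \<noteq> 0\<close> by (auto simp: fun_eq_iff neg sin_coeff_def power_mult_distrib elim!: oddE)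
  then show "(\<lambda>k. if even k then 0 else r ^ k * (- \<omega>\<^sup>2) ^ ((k - 1) div 2) / fact k)
      sums (sin (r * \<omega>) / \<omega>)"
    using sums_divide[OF sin_converges[of "r * \<omega>"], of \<omega>] by simp
qed

lemma traceless_square_2:
  fixes a b c :: real
  shows "(vector [vector [a, b], vector [c, - a]] :: real^2^2) ** vector [vector [a, b], vector [c, - a]]
    = (a\<^sup>2 + b * c) *\<^sub>R mat 1"
  by (simp add: vec_eq_iff forall_2 matrix_matrix_mult_def sum_2 mat_def power2_eq_square algebra_simps)

lemma matrix_exp_rotation:
  "matrix_exp (- (t *\<^sub>R (\<beta> *\<^sub>R k_gen))) =
    vector [vector [cos (\<beta> * t / 2), sin (\<beta> * t / 2)], vector [- sin (\<beta> * t / 2), cos (\<beta> * t / 2)]]"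
proof -
  \<comment> \<open>The entry \<open>- 0\<close> exhibits \<open>J\<close> as an instance of the general traceless matrix.\<close>
  define J :: "real^2^2" where "J = vector [vector [0, 1], vector [- 1, - 0]]"
  have "J ** J = (- (1\<^sup>2)) *\<^sub>R mat 1"
    unfolding J_def traceless_square_2 by simp
  then have "matrix_exp ((\<beta> * t / 2) *\<^sub>R J) = cos (\<beta> * t / 2) *\<^sub>R mat 1 + sin (\<beta> * t / 2) *\<^sub>R J"
    using matrix_exp_elliptic[of J 1] by simp
  moreover have "- (t *\<^sub>R (\<beta> *\<^sub>R k_gen)) = (\<beta> * t / 2) *\<^sub>R J"
    by (simp add: J_def k_gen_def matrix_unit_def vec_eq_iff forall_2)
  moreover have "cos (\<beta> * t / 2) *\<^sub>R mat 1 + sin (\<beta> * t / 2) *\<^sub>R J =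
    vector [vector [cos (\<beta> * t / 2), sin (\<beta> * t / 2)], vector [- sin (\<beta> * t / 2), cos (\<beta> * t / 2)]]"
    by (simp add: J_def vec_eq_iff forall_2 mat_def)
  ultimately show ?thesis by metis
qed

theorem theorem3:
  fixes \<beta> \<phi> t m n :: real
  assumes "\<beta>\<^sup>2 = 1 \<Longrightarrow> m = t / 2 \<and> n = 1"
    and "\<beta>\<^sup>2 < 1 \<Longrightarrow> m = sinh (t * sqrt (1 - \<beta>\<^sup>2) / 2) / sqrt (1 - \<beta>\<^sup>2)
                  \<and> n = cosh (t * sqrt (1 - \<beta>\<^sup>2) / 2)"
    and "\<beta>\<^sup>2 > 1 \<Longrightarrow> m = sin (t * sqrt (\<beta>\<^sup>2 - 1) / 2) / sqrt (\<beta>\<^sup>2 - 1)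
                  \<and> n = cos (t * sqrt (\<beta>\<^sup>2 - 1) / 2)"
  shows "geodesic \<beta> \<phi> t =
    vector
      [vector [n * cos (\<beta> * t / 2) + m * (cos (\<beta> * t / 2 + \<phi>) + \<beta> * sin (\<beta> * t / 2)),
               n * sin (\<beta> * t / 2) + m * (sin (\<beta> * t / 2 + \<phi>) - \<beta> * cos (\<beta> * t / 2))],
       vector [- n * sin (\<beta> * t / 2) + m * (sin (\<beta> * t / 2 + \<phi>) + \<beta> * cos (\<beta> * t / 2)),
               n * cos (\<beta> * t / 2) + m * (- cos (\<beta> * t / 2 + \<phi>) + \<beta> * sin (\<beta> * t / 2))]]"
proof -
  define B :: "real^2^2"
    where "B = vector [vector [cos \<phi>, sin \<phi> - \<beta>], vector [sin \<phi> + \<beta>, - cos \<phi>]]"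
  have "(cos \<phi>)\<^sup>2 + (sin \<phi> - \<beta>) * (sin \<phi> + \<beta>) = 1 - \<beta>\<^sup>2"
    using sin_cos_squared_add[of \<phi>] by (simp add: power2_eq_square algebra_simps)
  then have BB: "B ** B = (1 - \<beta>\<^sup>2) *\<^sub>R mat 1"
    unfolding B_def traceless_square_2 by simp
  have generator: "t *\<^sub>R (cos \<phi> *\<^sub>R p1 + sin \<phi> *\<^sub>R p2 + \<beta> *\<^sub>R k_gen) = (t / 2) *\<^sub>R B"
    by (simp add: B_def p1_def p2_def k_gen_def matrix_unit_def vec_eq_iff forall_2
        algebra_simps add_divide_distrib diff_divide_distrib)
  have first_factor: "matrix_exp ((t / 2) *\<^sub>R B) = n *\<^sub>R mat 1 + m *\<^sub>R B"
  proof (cases "\<beta>\<^sup>2" "1 :: real" rule: linorder_cases)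
    case less
    then show ?thesis
      using matrix_exp_hyperbolic[of B "sqrt (1 - \<beta>\<^sup>2)" "t / 2"] BB assms(2) by simp
  next
    case equal
    then show ?thesis
      using matrix_exp_parabolic[of B "t / 2"] BB assms(1) by simp
  next
    case greater
    then show ?thesis
      using matrix_exp_elliptic[of B "sqrt (\<beta>\<^sup>2 - 1)" "t / 2"] BB assms(3) by simp
  qed
  show ?thesis
    unfolding geodesic_def generator first_factor matrix_exp_rotation
    by (simp add: B_def vec_eq_iff forall_2 matrix_matrix_mult_def sum_2 mat_def cos_add sin_add
        algebra_simps)
qed

end
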